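(* Let $(\mathcal{P},\leq,\Omega)$ be a poset with a flow, and let $(\mathcal{Q},\leq)$ be a poset with a zero element and a join-dense subset $B\subset\mathcal{Q}$. For any order-preserving maps $\mathbf{F},\mathbf{G}:(\mathcal{P},\leq)\to(\mathcal{Q},\leq)$, $$d_{\mathrm{I}}(\mathbf{F},\mathbf{G})=\sup_{b\in B}d_{\widehat{\Omega}}\big(\mathbf{F}^{-1}(b^\uparrow),\mathbf{G}^{-1}(b^\uparrow)\big).$$
   Context: Posets are nonempty. A (strict) flow on a poset $\mathcal{P}$ is a family $\Omega=\{\Omega_\varepsilon:\mathcal{P}\to\mathcal{P}\}_{\varepsilon\in[0,\infty)}$ of order-preserving maps such that $\Omega_s\leq\Omega_t$ pointwise for $s\leq t$, $\Omega_t\Omega_s=\Omega_{t+s}$ for all $s,t\in[0,\infty)$, and $\Omega_0=\mathrm{id}_{\mathcal{P}}$. Order-preserving maps $\mathbf{F},\mathbf{G}:\mathcal{P}\to\mathcal{Q}$ are $\varepsilon$-interleaved if $\mathbf{F}(p)\leq\mathbf{G}(\Omega_\varepsilon(p))$ and $\mathbf{G}(p)\leq\mathbf{F}(\Omega_\varepsilon(p))$ for all $p\in\mathcal{P}$; $d_{\mathrm{I}}(\mathbf{F},\mathbf{G})\in[0,\infty]$ is the infimum of all $\varepsilon\in[0,\infty)$ such that they are $\varepsilon$-interleaved ($\infty$ if there is none). An upper set of $\mathcal{P}$ is a subset $A$ such that $p\in A$, $p\leq q$ imply $q\in A$; $U(\mathcal{P})$ denotes the set of upper sets ordered by inclusion.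 For $A\in U(\mathcal{P})$ and $\varepsilon\geq 0$, $\widehat{\Omega}_\varepsilon(A):=\{p\in\mathcal{P}:\Omega_\varepsilon(p)\in A\}$. For $A,A'\in U(\mathcal{P})$, $d_{\widehat{\Omega}}(A,A'):=\inf\{\varepsilon\in[0,\infty): A\subset\widehat{\Omega}_\varepsilon(A')\text{ and }A'\subset\widehat{\Omega}_\varepsilon(A)\}$ ($\infty$ if there is no such $\varepsilon$). A zero element of $\mathcal{Q}$ is an element $0$ with $0\leq q$ for all $q\in\mathcal{Q}$. A subset $B\subset\mathcal{Q}$ is join-dense if every element of $\mathcal{Q}$ is the join (least upper bound) of some subset of $B$ (the join of the empty set is the zero element). For $b\in\mathcal{Q}$, $b^\uparrow:=\{q\in\mathcal{Q}:b\leq q\}$, so $\mathbf{F}^{-1}(b^\uparrow)=\{p: b\leq\mathbf{F}(p)\}$. Suprema are taken in $[0,\infty]$. *)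

theory Defs
  imports "HOL-Library.Extended_Nonnegative_Real" "HOL-Library.Lub_Glb"
begin

text \<open>
  Posets are types of class \<open>order\<close>. A flow is indexed by \<open>real\<close>, but only its values at
  nonnegative indices are constrained or ever used.
\<close>

definition flow :: "(real \<Rightarrow> 'p::order \<Rightarrow> 'p) \<Rightarrow> bool" where
  "flow \<Omega> \<longleftrightarrow>
     (\<forall>\<epsilon>\<ge>0. mono (\<Omega> \<epsilon>)) \<and>
     (\<forall>s t p. 0 \<le> s \<and> s \<le> t \<longrightarrow> \<Omega> s p \<le> \<Omega> t p) \<and>
     (\<forall>s\<ge>0. \<forall>t\<ge>0. \<Omega> t \<circ> \<Omega> s = \<Omega> (t + s)) \<and>
     \<Omega> 0 = id"

definition interleaved ::
  "(real \<Rightarrow> 'p::order \<Rightarrow> 'p) \<Rightarrow> real \<Rightarrow> ('p \<Rightarrow> 'q::order) \<Rightarrow> ('p \<Rightarrow> 'q) \<Rightarrow> bool" where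
  "interleaved \<Omega> \<epsilon> F G \<longleftrightarrow> (\<forall>p. F p \<le> G (\<Omega> \<epsilon> p)) \<and> (\<forall>p. G p \<le> F (\<Omega> \<epsilon> p))"

text \<open>In \<open>ennreal\<close>, the infimum of the empty set is \<open>\<infinity>\<close> and the supremum of the empty set is 0.\<close>

definition interleaving_dist ::
  "(real \<Rightarrow> 'p::order \<Rightarrow> 'p) \<Rightarrow> ('p \<Rightarrow> 'q::order) \<Rightarrow> ('p \<Rightarrow> 'q) \<Rightarrow> ennreal" where
  "interleaving_dist \<Omega> F G = (INF \<epsilon> \<in> {\<epsilon>. 0 \<le> \<epsilon> \<and> interleaved \<Omega> \<epsilon> F G}. ennreal \<epsilon>)"

definition upper_sets :: "'p::order set set" where
  "upper_sets = {A. \<forall>p q. p \<in> A \<and> p \<le> q \<longrightarrow> q \<in> A}"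

definition hat_flow :: "(real \<Rightarrow> 'p::order \<Rightarrow> 'p) \<Rightarrow> real \<Rightarrow> 'p set \<Rightarrow> 'p set" where
  "hat_flow \<Omega> \<epsilon> A = {p. \<Omega> \<epsilon> p \<in> A}"

text \<open>
  The distance below is meant for elements of \<open>upper_sets\<close>; the two lemmas that follow show
  that the sets involved are upper sets.
\<close>

definition hat_dist :: "(real \<Rightarrow> 'p::order \<Rightarrow> 'p) \<Rightarrow> 'p set \<Rightarrow> 'p set \<Rightarrow> ennreal" where
  "hat_dist \<Omega> A A' =
     (INF \<epsilon> \<in> {\<epsilon>. 0 \<le> \<epsilon> \<and> A \<subseteq> hat_flow \<Omega> \<epsilon> A' \<and> A' \<subseteq> hat_flow \<Omega> \<epsilon> A}. ennreal \<epsilon>)"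

lemma hat_flow_upper_sets:
  assumes "flow \<Omega>" and "0 \<le> \<epsilon>" and "A \<in> upper_sets"
  shows "hat_flow \<Omega> \<epsilon> A \<in> upper_sets"
  using assms unfolding flow_def upper_sets_def hat_flow_def by (blast dest: monoD)

lemma vimage_atLeast_upper_sets:
  assumes "mono F"
  shows "F -` {b..} \<in> upper_sets"
  using assms unfolding upper_sets_def by (auto dest: monoD intro: order_trans)

definition join_dense :: "'q::order set \<Rightarrow> bool" where
  "join_dense B \<longleftrightarrow> (\<forall>q. \<exists>C\<subseteq>B. isLub UNIV C q)"

end

theory Submission
  imports Defs
begin

text \<open>
  In a poset with a join-dense subset \<open>B\<close>, the order is detected by the elements of \<open>B\<close>:
  \<open>x \<le> y\<close> iff every \<open>b \<in> B\<close> below \<open>x\<close> is below \<open>y\<close>.  Applied to \<open>F p\<close> and \<open>G (\<Omega> \<epsilon> p)\<close>, and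
  with the roles of \<open>F\<close> and \<open>G\<close> exchanged, this says that for each single \<open>\<epsilon>\<close> the maps are
  \<open>\<epsilon>\<close>-interleaved iff, for all \<open>b \<in> B\<close>, the superlevel sets of \<open>F\<close> and \<open>G\<close> at \<open>b\<close> are within
  shift \<open>\<epsilon>\<close> of each other (\<open>interleaved_iff_superlevel_sets\<close>).

  It remains to exchange the infimum over \<open>\<epsilon>\<close> with the supremum over \<open>b\<close>.  The inequality
  \<open>SUP INF \<le> INF SUP\<close> is automatic.  For the other one, let \<open>e\<close> exceed the supremum.  Each \<open>b\<close>
  then has an admissible shift below \<open>e\<close>, but that shift depends on \<open>b\<close>; since admissible
  shifts can be enlarged (\<open>hat_dist_less_imp_subset\<close>), \<open>e\<close> itself serves all \<open>b\<close> at once.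
\<close>

lemma join_dense_le_iff:
  assumes "join_dense B"
  shows "x \<le> y \<longleftrightarrow> (\<forall>b\<in>B. b \<le> x \<longrightarrow> b \<le> y)"
proof
  show "x \<le> y \<Longrightarrow> \<forall>b\<in>B. b \<le> x \<longrightarrow> b \<le> y"
    by (blast intro: order_trans)
next
  assume below: "\<forall>b\<in>B. b \<le> x \<longrightarrow> b \<le> y"
  obtain C where "C \<subseteq> B" and lub: "isLub UNIV C x"
    using assms unfolding join_dense_def by blast
  have "\<forall>c\<in>C. c \<le> y"
    using below \<open>C \<subseteq> B\<close> lub by (auto dest: isLubD2)
  then have "isUb UNIV C y"
    by (simp add: isUb_def setle_def)
  then show "x \<le> y"
    by (rule isLub_le_isUb[OF lub])
qed

lemma interleaved_iff_superlevel_sets: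
  assumes "join_dense B"
  shows "interleaved \<Omega> \<epsilon> F G \<longleftrightarrow>
    (\<forall>b\<in>B. F -` {b..} \<subseteq> hat_flow \<Omega> \<epsilon> (G -` {b..}) \<and> G -` {b..} \<subseteq> hat_flow \<Omega> \<epsilon> (F -` {b..}))"
  unfolding interleaved_def hat_flow_def
    join_dense_le_iff[OF assms, of "F p" "G q" for p q]
    join_dense_le_iff[OF assms, of "G p" "F q" for p q]
  by (auto simp: subset_iff)

lemma hat_flow_mono_shift:
  assumes "flow \<Omega>" and "A \<in> upper_sets" and "0 \<le> s" and "s \<le> t"
  shows "hat_flow \<Omega> s A \<subseteq> hat_flow \<Omega> t A"
  using assms unfolding flow_def upper_sets_def hat_flow_def by blast

text \<open>
  The infimum defining \<open>hat_dist\<close> need not be attained, but any \<open>e\<close> strictly above it is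
  admissible: some admissible shift is smaller than \<open>e\<close>, and the shifts of an upper set grow
  with the parameter.
\<close>

lemma hat_dist_less_imp_subset:
  assumes "flow \<Omega>" and "A \<in> upper_sets" and "A' \<in> upper_sets"
    and less: "hat_dist \<Omega> A A' < ennreal e"
  shows "A \<subseteq> hat_flow \<Omega> e A' \<and> A' \<subseteq> hat_flow \<Omega> e A"
proof -
  obtain s where "0 \<le> s" and s: "A \<subseteq> hat_flow \<Omega> s A'" "A' \<subseteq> hat_flow \<Omega> s A"
    and "ennreal s < ennreal e"
    using less unfolding hat_dist_def by (auto simp: INF_less_iff)
  then have "s \<le> e"
    by (simp add: ennreal_less_iff)
  then show ?thesis
    using s hat_flow_mono_shift[OF assms(1) _ \<open>0 \<le> s\<close>] assms(2,3) by blast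
qed

theorem theorem3p10:
  fixes \<Omega> :: "real \<Rightarrow> 'p::order \<Rightarrow> 'p"
    and F G :: "'p \<Rightarrow> 'q::order_bot"
    and B :: "'q set"
  assumes "flow \<Omega>"
    and "join_dense B"
    and "mono F" and "mono G"
  shows "interleaving_dist \<Omega> F G = (SUP b\<in>B. hat_dist \<Omega> (F -` {b..}) (G -` {b..}))"
    (is "_ = ?S")
proof (rule antisym)
  show "?S \<le> interleaving_dist \<Omega> F G"
    unfolding interleaving_dist_def
  proof (intro SUP_least INF_greatest)
    fix b \<epsilon>
    assume "b \<in> B" and "\<epsilon> \<in> {\<epsilon>. 0 \<le> \<epsilon> \<and> interleaved \<Omega> \<epsilon> F G}"
    then show "hat_dist \<Omega> (F -` {b..}) (G -` {b..}) \<le> ennreal \<epsilon>"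
      unfolding hat_dist_def interleaved_iff_superlevel_sets[OF assms(2)]
      by (intro INF_lower) blast
  qed
next
  show "interleaving_dist \<Omega> F G \<le> ?S"
  proof (rule dense_ge)
    fix z assume "?S < z"
    show "interleaving_dist \<Omega> F G \<le> z"
    proof (cases z)
      case (real e)
      have "hat_dist \<Omega> (F -` {b..}) (G -` {b..}) < ennreal e" if "b \<in> B" for b
        using SUP_upper[OF that] \<open>?S < z\<close> real by (metis (no_types, lifting) le_less_trans)
      then have "interleaved \<Omega> e F G"
        unfolding interleaved_iff_superlevel_sets[OF assms(2)]
        using hat_dist_less_imp_subset[OF assms(1)] vimage_atLeast_upper_sets assms(3,4)
        by blast
      then show ?thesis
        unfolding interleaving_dist_def using real by (auto intro: INF_lower2)
    qed simp
  qed
qed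

end
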